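(* A noisy CFMM mechanism is priceable if the noise trade distribution $\mathcal{D}$ is always zero-mean.
   Context: CFMM. A constant function market maker (CFMM) trades a volatile asset $X$ against a stable numeraire $Y$. It is given by a trading function $f$ that is quasi-concave, continuous and non-decreasing in both coordinates on $\mathbb{R}^2_+$. With reserves (state) $(x,y)$ it accepts a trade $(\Delta_x,\Delta_y)$, leading to reserves $(x+\Delta_x,y-\Delta_y)$, if and only if $f(x+\Delta_x,y-\Delta_y)=f(x,y)$. On a given level curve of $f$ the amount $x$ of $X$ uniquely determines the amount of $Y$, denoted $\mathcal{Y}(x)$. Fees are not added to the reserves, so the CFMM stays on its initial level curve. It is assumed that the CFMM never runs out of an asset. Spot price. The spot price at a state is $\frac{\partial f}{\partial x}/\frac{\partial f}{\partial y}$ there (any subgradient where $f$ is not differentiable). On a given level curve, the spot price is monotonically decreasing in the amount $x$ of $X$ in the reserves, tends to $\infty$ as $x\to 0$ and to $0$ as $x\to\infty$. Noisy CFMM mechanism. At state $(x,\mathcal{Y}(x))$, a trader sells $\Delta$ units of $X$ to the CFMM ($\Delta<0$ means buying $X$) and specifies privacy requirements $(\tau,\varepsilon)$: a masking interval $\tau=[l,u]$ with $\Delta\in\tau$ and a privacy level $\varepsilon\ge 0$ (lower means more privacy; $\varepsilon=\infty$ is allowed and means no privacy). The trader receives $\mathcal{Y}(x)-\mathcal{Y}(x+\Delta)$ units of $Y$ and pays a privacy fee $\gamma$; the trading fee is assumed to be zero. The CFMM then immediately makes a random noise trade of $\eta\sim\mathcal{D}$ units of $X$ with a hidden private account, so that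 the new state is $x'=x+\Delta+\eta$, $y'=\mathcal{Y}(x')$, and this state can be queried by the next trader. The hidden account is assumed never to run dry; if it cannot support the maximum possible noise for a trade request, the request is rejected. The noise trade distribution $\mathcal{D}=\mathcal{D}(\Delta,\varepsilon,\tau)$ has bounded support and, for a given CFMM, depends only on the trade amount $\Delta$ and privacy specification $(\tau,\varepsilon)$, not on the CFMM state; "always zero-mean" means zero-mean for every $(\Delta,\varepsilon,\tau)$. When $\varepsilon=\infty$ or $\tau=\{\Delta\}$, both the noise trade and the privacy fee are zero. External market. There is an external market with infinite liquidity; the price $\hat p$ of $X$ in units of $Y$ on it is called the true price. Arbitrageurs know the true price and can trade both with the CFMM and on the external market. Additional arbitrage. Let a CFMM $C$ and a noisy CFMM $\tilde C$ have identical states and trading functions. For any true price $\hat p$, the additional arbitrage is the difference of the maximum possible profit in expectation from trading with $\tilde C$ and $C$. Priceability. A noisy CFMM mechanism is priceable if there always exists a privacy fee which depends only on the CFMM state, its trading function, and the noise trade distribution (in particular, not on the true price $\hat p$) such that the mechanism has the following property: for any true price and CFMM state, the additional arbitrage is zero. *)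

theory Defs
  imports "HOL-Probability.Probability"
begin

type_synonym reserves = "real \<times> real"  \<comment> \<open>amounts of \<open>X\<close> and of the numeraire \<open>Y\<close>\<close>
type_synonym trading_function = "reserves \<Rightarrow> real"

definition quadrant :: "reserves set" where
  "quadrant = {0..} \<times> {0..}"

definition quasiconcave_on :: "'a::real_vector set \<Rightarrow> ('a \<Rightarrow> real) \<Rightarrow> bool" where
  "quasiconcave_on S f \<longleftrightarrow> convex S \<and> (\<forall>c. convex {z \<in> S. c \<le> f z})"

definition is_trading_function :: "trading_function \<Rightarrow> bool" where
  "is_trading_function f \<longleftrightarrow>
     quasiconcave_on quadrant f \<and> continuous_on quadrant f \<and>
     (\<forall>x x' y. 0 \<le> x \<and> x \<le> x' \<and> 0 \<le> y \<longrightarrow> f (x, y) \<le> f (x', y)) \<and>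
     (\<forall>x y y'. 0 \<le> x \<and> 0 \<le> y \<and> y \<le> y' \<longrightarrow> f (x, y) \<le> f (x, y'))"

text \<open>The function \<open>x \<mapsto> \<Y>(x)\<close> of the level curve \<open>f = c\<close>. The value \<open>0\<close> for \<open>x \<le> 0\<close> is a
  dummy, which never enters a trade that is carried out.\<close>

definition level_y :: "trading_function \<Rightarrow> real \<Rightarrow> real \<Rightarrow> real" where
  "level_y f c x = (if 0 < x then THE y. 0 < y \<and> f (x, y) = c else 0)"

text \<open>At a point where \<open>f\<close> is not differentiable the spot price is formed from any subgradient.
  As \<open>f\<close> is only quasi-concave, a subgradient is a normal of the upper level set. Every
  supergradient of a concave \<open>f\<close> is one.\<close>

definition quasi_subgradient :: "trading_function \<Rightarrow> reserves \<Rightarrow> reserves \<Rightarrow> bool" where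
  "quasi_subgradient f s g \<longleftrightarrow> (\<forall>z \<in> quadrant. f s \<le> f z \<longrightarrow> 0 \<le> g \<bullet> (z - s))"

definition is_spot_price :: "trading_function \<Rightarrow> reserves \<Rightarrow> real \<Rightarrow> bool" where
  "is_spot_price f s \<pi> \<longleftrightarrow>
     (\<exists>g. snd g \<noteq> 0 \<and> \<pi> = fst g / snd g \<and>
          (if f differentiable (at s) then GDERIV f s :> g else quasi_subgradient f s g))"

text \<open>The standing assumptions on a level curve. They are required for every selection \<open>\<sigma>\<close> of spot
  prices along the curve, since a spot price need not be unique at a kink.\<close>

definition regular_level :: "trading_function \<Rightarrow> real \<Rightarrow> bool" where
  "regular_level f c \<longleftrightarrow>
     (\<forall>x>0. \<exists>!y. 0 < y \<and> f (x, y) = c) \<and>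
     (\<forall>x>0. \<exists>\<pi>. is_spot_price f (x, level_y f c x) \<pi>) \<and>
     (\<forall>\<sigma>. (\<forall>x>0. is_spot_price f (x, level_y f c x) (\<sigma> x)) \<longrightarrow>
          antimono_on {0<..} \<sigma> \<and> filterlim \<sigma> at_top (at_right 0) \<and> (\<sigma> \<longlongrightarrow> 0) at_top)"

definition cfmm_state :: "trading_function \<Rightarrow> reserves \<Rightarrow> bool" where
  "cfmm_state f s \<longleftrightarrow> 0 < fst s \<and> 0 < snd s \<and> regular_level f (f s)"

definition move :: "trading_function \<Rightarrow> reserves \<Rightarrow> real \<Rightarrow> reserves" where
  "move f s \<Delta> = (fst s + \<Delta>, level_y f (f s) (fst s + \<Delta>))"

text \<open>A noise family gives the law of the noise trade for a trade amount \<open>\<Delta>\<close>, a privacy level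
  \<open>\<epsilon>\<close> (\<open>\<epsilon> = \<infinity>\<close> is allowed) and a masking interval \<open>\<tau>\<close>.\<close>

type_synonym noise_family = "real \<Rightarrow> ennreal \<Rightarrow> real set \<Rightarrow> real measure"

definition valid_request :: "real \<Rightarrow> real set \<Rightarrow> bool" where
  "valid_request \<Delta> \<tau> \<longleftrightarrow> (\<exists>l u. \<tau> = {l..u}) \<and> \<Delta> \<in> \<tau>"

definition is_noise_family :: "noise_family \<Rightarrow> bool" where
  "is_noise_family D \<longleftrightarrow>
     (\<forall>\<Delta> \<epsilon> \<tau>. valid_request \<Delta> \<tau> \<longrightarrow>
        prob_space (D \<Delta> \<epsilon> \<tau>) \<and> sets (D \<Delta> \<epsilon> \<tau>) = sets borel \<and>
        (\<exists>B. AE \<eta> in D \<Delta> \<epsilon> \<tau>. \<bar>\<eta>\<bar> \<le> B) \<and>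
        (\<epsilon> = \<infinity> \<or> \<tau> = {\<Delta>} \<longrightarrow> D \<Delta> \<epsilon> \<tau> = return borel 0))"

definition noisy_cfmm :: "trading_function \<Rightarrow> noise_family \<Rightarrow> bool" where
  "noisy_cfmm f D \<longleftrightarrow> is_trading_function f \<and> is_noise_family D"

definition always_zero_mean :: "noise_family \<Rightarrow> bool" where
  "always_zero_mean D \<longleftrightarrow>
     (\<forall>\<Delta> \<epsilon> \<tau>. valid_request \<Delta> \<tau> \<longrightarrow> prob_space.expectation (D \<Delta> \<epsilon> \<tau>) (\<lambda>\<eta>. \<eta>) = 0)"

text \<open>A fee rule sees the trading function, the reserves at which the noise trade is made (that
  is, those right after the trader's own trade) and the law of the noise trade.\<close>

type_synonym fee_rule = "trading_function \<Rightarrow> reserves \<Rightarrow> real measure \<Rightarrow> real"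

text \<open>The hidden account holds \<open>h = (h\<^sub>x, h\<^sub>y)\<close>. A noise trade of \<open>\<eta>\<close> units moves \<open>\<eta>\<close> units of \<open>X\<close> from
  the account to the CFMM, in exchange for \<open>Y\<close>. A request is carried out only if, for all
  possible noise, neither the CFMM nor the account runs out of an asset.\<close>

definition account_after :: "trading_function \<Rightarrow> reserves \<Rightarrow> real \<Rightarrow> real \<times> real \<Rightarrow> real \<times> real" where
  "account_after f s \<eta> h = (fst h - \<eta>, snd h + (snd s - snd (move f s \<eta>)))"

definition accepted ::
  "trading_function \<Rightarrow> noise_family \<Rightarrow> reserves \<Rightarrow> real \<times> real \<Rightarrow> real \<Rightarrow> ennreal \<Rightarrow> real set \<Rightarrow> bool"
  where
  "accepted f D s h \<Delta> \<epsilon> \<tau> \<longleftrightarrow>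
     valid_request \<Delta> \<tau> \<and> 0 < fst s + \<Delta> \<and>
     (AE \<eta> in D \<Delta> \<epsilon> \<tau>. 0 < fst s + \<Delta> + \<eta> \<and>
        0 \<le> fst (account_after f (move f s \<Delta>) \<eta> h) \<and>
        0 \<le> snd (account_after f (move f s \<Delta>) \<eta> h))"

text \<open>An adaptive strategy of an arbitrageur. \<open>External v k\<close> sells \<open>v\<close> units of \<open>X\<close> on the external
  market (buys, if \<open>v < 0\<close>). \<open>Request \<Delta> \<epsilon> \<tau> k\<close> submits a request to the CFMM and goes on with
  \<open>k (Some s')\<close> if the CFMM is then queried in state \<open>s'\<close>, and with \<open>k None\<close> if the request is
  rejected. Every play is finite, although its length need not be bounded in advance.\<close>

datatype strategy =
    Stop
  | External real strategy
  | Request real ennreal "real set" "reserves option \<Rightarrow> strategy"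

text \<open>Expected final wealth, in units of \<open>Y\<close> and net of what has been paid before, of an
  arbitrageur who holds \<open>q\<close> units of \<open>X\<close> (\<open>q < 0\<close> is a short position) while the CFMM is in state
  \<open>s\<close> and the hidden account holds \<open>h\<close>. Upon \<open>Stop\<close> the position is closed at the true price \<open>p\<close>.\<close>

primrec expected_profit ::
  "trading_function \<Rightarrow> noise_family \<Rightarrow> fee_rule \<Rightarrow> real \<Rightarrow> strategy \<Rightarrow> reserves \<Rightarrow> real \<times> real \<Rightarrow> real \<Rightarrow> real"
  where
  "expected_profit f D \<gamma> p Stop s h q = p * q"
| "expected_profit f D \<gamma> p (External v k) s h q = p * v + expected_profit f D \<gamma> p k s h (q - v)"
| "expected_profit f D \<gamma> p (Request \<Delta> \<epsilon> \<tau> k) s h q =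
     (if accepted f D s h \<Delta> \<epsilon> \<tau> then
        (let s1 = move f s \<Delta> in
         snd s - snd s1 - \<gamma> f s1 (D \<Delta> \<epsilon> \<tau>) +
         (\<integral>\<eta>. expected_profit f D \<gamma> p (k (Some (move f s1 \<eta>)))
               (move f s1 \<eta>) (account_after f s1 \<eta> h) (q - \<Delta>) \<partial>D \<Delta> \<epsilon> \<tau>))
      else expected_profit f D \<gamma> p (k None) s h q)"

text \<open>The strategies for which the nested expectations above exist. This excludes the default value
  \<open>0\<close> of the integral of a function that is not integrable.\<close>

primrec well_defined_profit ::
  "trading_function \<Rightarrow> noise_family \<Rightarrow> fee_rule \<Rightarrow> real \<Rightarrow> strategy \<Rightarrow> reserves \<Rightarrow> real \<times> real \<Rightarrow> real \<Rightarrow> bool"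
  where
  "well_defined_profit f D \<gamma> p Stop s h q = True"
| "well_defined_profit f D \<gamma> p (External v k) s h q = well_defined_profit f D \<gamma> p k s h (q - v)"
| "well_defined_profit f D \<gamma> p (Request \<Delta> \<epsilon> \<tau> k) s h q =
     (if accepted f D s h \<Delta> \<epsilon> \<tau> then
        (let s1 = move f s \<Delta> in
         integrable (D \<Delta> \<epsilon> \<tau>) (\<lambda>\<eta>. expected_profit f D \<gamma> p (k (Some (move f s1 \<eta>)))
               (move f s1 \<eta>) (account_after f s1 \<eta> h) (q - \<Delta>)) \<and>
         (AE \<eta> in D \<Delta> \<epsilon> \<tau>. well_defined_profit f D \<gamma> p (k (Some (move f s1 \<eta>)))
               (move f s1 \<eta>) (account_after f s1 \<eta> h) (q - \<Delta>)))
      else well_defined_profit f D \<gamma> p (k None) s h q)"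

definition is_max_profit ::
  "trading_function \<Rightarrow> noise_family \<Rightarrow> fee_rule \<Rightarrow> real \<Rightarrow> reserves \<Rightarrow> real \<times> real \<Rightarrow> real \<Rightarrow> bool" where
  "is_max_profit f D \<gamma> p s h m \<longleftrightarrow>
     (\<exists>k. well_defined_profit f D \<gamma> p k s h 0 \<and> expected_profit f D \<gamma> p k s h 0 = m) \<and>
     (\<forall>k. well_defined_profit f D \<gamma> p k s h 0 \<longrightarrow> expected_profit f D \<gamma> p k s h 0 \<le> m)"

text \<open>The CFMM without noise is the case of the noise trade \<open>0\<close> and the fee \<open>0\<close>.\<close>

definition no_noise :: noise_family where
  "no_noise = (\<lambda>\<Delta> \<epsilon> \<tau>. return borel 0)"

definition no_fee :: fee_rule where
  "no_fee = (\<lambda>f s M. 0)"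

text \<open>\<open>is_additional_arbitrage f D \<gamma> p s h a\<close> includes that both maxima exist.\<close>

definition is_additional_arbitrage ::
  "trading_function \<Rightarrow> noise_family \<Rightarrow> fee_rule \<Rightarrow> real \<Rightarrow> reserves \<Rightarrow> real \<times> real \<Rightarrow> real \<Rightarrow> bool" where
  "is_additional_arbitrage f D \<gamma> p s h a \<longleftrightarrow>
     (\<exists>m' m. is_max_profit f D \<gamma> p s h m' \<and> is_max_profit f no_noise no_fee p s h m \<and> a = m' - m)"

text \<open>The first conjunct says that no fee is due when there is no noise trade. By
  \<^const>\<open>is_noise_family\<close> this covers the requests with \<open>\<epsilon> = \<infinity>\<close> or \<open>\<tau> = {\<Delta>}\<close>.\<close>

definition priceable :: "trading_function \<Rightarrow> noise_family \<Rightarrow> bool" where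
  "priceable f D \<longleftrightarrow>
     (\<exists>\<gamma> :: fee_rule.
        (\<forall>s. \<gamma> f s (return borel 0) = 0) \<and>
        (\<forall>p>0. \<forall>s h. cfmm_state f s \<and> 0 \<le> fst h \<and> 0 \<le> snd h \<longrightarrow>
           is_additional_arbitrage f D \<gamma> p s h 0))"

end

theory Submission
  imports Defs
begin

text \<open>The fee is the Jensen gap \<open>E[\<Y>(x + \<eta>)] - \<Y>(x)\<close>. With it, and with zero-mean noise, the sum of the
  arbitrageur's wealth and of the reserves, both valued at the true price \<open>p\<close>, is a martingale under
  every strategy. Hence no strategy gains more than the excess of \<open>p x + \<Y>(x)\<close> over its
  minimum on the level curve, noise or not. A single trade with \<open>\<epsilon> = \<infinity>\<close> to the minimizer gains exactly
  this. The minimizer exists because \<open>\<Y>\<close> is convex with the negated spot price as a subgradient.\<close>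

section \<open>Gradients as normals of upper level sets\<close>

text \<open>If the derivative towards \<open>z\<close> were negative, \<open>f\<close> would drop
  below \<open>f s\<close> just after leaving \<open>s\<close>, although the segment to
  \<open>z\<close> stays in a convex upper level set. Smooth points and kinks can thus be treated
  alike.\<close>

lemma gderiv_quasi_subgradient:
  assumes "quasiconcave_on quadrant f" and "s \<in> quadrant" and g: "GDERIV f s :> g"
  shows "quasi_subgradient f s g"
  unfolding quasi_subgradient_def
proof (intro ballI impI, rule ccontr)
  fix z
  assume z: "z \<in> quadrant" "f s \<le> f z" and neg: "\<not> 0 \<le> g \<bullet> (z - s)"
  define \<phi> where "\<phi> t = f (s + t *\<^sub>R (z - s))" for t :: real
  have f': "(f has_derivative (\<lambda>h. h \<bullet> g)) (at (s + 0 *\<^sub>R (z - s)))"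
    using g by (simp add: gderiv_def)
  have "((\<lambda>t. s + t *\<^sub>R (z - s)) has_derivative (\<lambda>t. t *\<^sub>R (z - s))) (at 0)"
    by (auto intro!: derivative_eq_intros)
  from has_derivative_compose[OF this f'] have "(\<phi> has_real_derivative (g \<bullet> (z - s))) (at 0)"
    by (simp add: has_field_derivative_def \<phi>_def[abs_def] inner_commute
        mult.commute[of _ "_ \<bullet> _"])
  from DERIV_neg_dec_right[OF this] neg obtain d
    where d: "d > 0" "\<And>t. 0 < t \<Longrightarrow> t < d \<Longrightarrow> \<phi> t < \<phi> 0" by auto
  \<comment> \<open>Small enough for the strict decrease, and at most 1 so that the point lies on
    the segment.\<close>
  define t where "t = min (d / 2) 1"
  have t: "0 < t" "t < d" "t \<le> 1" using d(1) by (auto simp: t_def)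
  have "convex {z \<in> quadrant. f s \<le> f z}"
    using assms(1) by (simp add: quasiconcave_on_def)
  with assms(2) z t have "(1 - t) *\<^sub>R s + t *\<^sub>R z \<in> {z \<in> quadrant. f s \<le> f z}"
    by (intro convexD_alt) auto
  moreover have "(1 - t) *\<^sub>R s + t *\<^sub>R z = s + t *\<^sub>R (z - s)"
    by (simp add: algebra_simps)
  ultimately have "\<phi> 0 \<le> \<phi> t" by (simp add: \<phi>_def)
  with d(2)[OF t(1,2)] show False by simp
qed

section \<open>Convex geometry of one level curve\<close>

locale level_curve =
  fixes f :: trading_function and c :: real
  assumes trading: "is_trading_function f" and regular: "regular_level f c"
begin

abbreviation Y :: "real \<Rightarrow> real" where "Y \<equiv> level_y f c"

lemma level_ex1: "0 < x \<Longrightarrow> \<exists>!y. 0 < y \<and> f (x, y) = c"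
  using regular unfolding regular_level_def by simp

lemma Y_pos: "0 < x \<Longrightarrow> 0 < Y x" and f_Y: "0 < x \<Longrightarrow> f (x, Y x) = c"
  using theI'[OF level_ex1[of x]] by (auto simp: level_y_def)

lemma Y_unique: "0 < x \<Longrightarrow> 0 < y \<Longrightarrow> f (x, y) = c \<Longrightarrow> y = Y x"
  using level_ex1[of x] Y_pos[of x] f_Y[of x] by blast

lemma f_mono_y: "0 \<le> x \<Longrightarrow> 0 \<le> y \<Longrightarrow> y \<le> y' \<Longrightarrow> f (x, y) \<le> f (x, y')"
  using trading by (simp add: is_trading_function_def)

text \<open>Monotonicity alone would allow \<open>f\<close> to be constant just below
  \<open>Y x\<close>; uniqueness of the level point excludes this. The upper level set is therefore
  the epigraph of \<open>Y\<close>, which turns quasi-concavity of \<open>f\<close> into convexity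
  of \<open>Y\<close>.\<close>

lemma upper_level_iff:
  assumes "0 < x" "0 < y"
  shows "c \<le> f (x, y) \<longleftrightarrow> Y x \<le> y"
proof
  assume "Y x \<le> y"
  then show "c \<le> f (x, y)"
    using f_mono_y[of x "Y x" y] f_Y[of x] Y_pos[of x] assms by simp
next
  assume c: "c \<le> f (x, y)"
  show "Y x \<le> y"
  proof (rule ccontr)
    assume *: "\<not> Y x \<le> y"
    then have "f (x, y) \<le> c"
      using f_mono_y[of x y "Y x"] f_Y[of x] assms by simp
    with c have "f (x, y) = c" by simp
    with Y_unique assms * show False by auto
  qed
qed

lemma convex_on_Y: "convex_on {0<..} Y"
proof (rule convex_onI)
  fix t x x' :: real
  assume t: "0 < t" "t < 1" and x: "x \<in> {0<..}" and x': "x' \<in> {0<..}"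
  have "convex {z \<in> quadrant. c \<le> f z}"
    using trading by (simp add: is_trading_function_def quasiconcave_on_def)
  moreover have "(x, Y x) \<in> {z \<in> quadrant. c \<le> f z}" "(x', Y x') \<in> {z \<in> quadrant. c \<le> f z}"
    using x x' Y_pos f_Y by (auto simp: quadrant_def less_imp_le)
  ultimately have "(1 - t) *\<^sub>R (x, Y x) + t *\<^sub>R (x', Y x') \<in> {z \<in> quadrant. c \<le> f z}"
    using t by (intro convexD_alt) auto
  then have "c \<le> f ((1 - t) * x + t * x', (1 - t) * Y x + t * Y x')" by simp
  moreover have "0 < (1 - t) * x + t * x'" "0 < (1 - t) * Y x + t * Y x'"
    using t x x' Y_pos[of x] Y_pos[of x'] by (simp_all add: add_pos_pos)
  ultimately show "Y ((1 - t) *\<^sub>R x + t *\<^sub>R x') \<le> (1 - t) * Y x + t * Y x'"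
    by (simp add: upper_level_iff)
qed simp

lemma continuous_on_Y: "continuous_on {0<..} Y"
  by (rule convex_on_continuous[OF _ convex_on_Y]) simp

lemma measurable_Y [measurable]: "Y \<in> borel_measurable borel"
proof -
  \<comment> \<open>Continuity is known on the positive axis only; the dummy value 0 elsewhere makes
    \<open>Y\<close> Borel on the whole line.\<close>
  have "Y = (\<lambda>x. if x \<in> {0<..} then Y x else 0)"
    by (auto simp: level_y_def)
  moreover have "\<dots> \<in> borel_measurable borel"
    by (rule borel_measurable_continuous_on_if) (auto intro: continuous_on_Y)
  ultimately show ?thesis by simp
qed

text \<open>A normal of the upper level set supports the epigraph of \<open>Y\<close> at
  \<open>(x, Y x)\<close>; dividing by its positive second component gives the slope
  \<open>- \<pi>\<close>.\<close>

lemma spot_price_subgradient: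
  assumes "is_spot_price f (x, Y x) \<pi>" "0 < x" "0 < x'"
  shows "Y x - \<pi> * (x' - x) \<le> Y x'"
proof -
  obtain g where g: "snd g \<noteq> 0" "\<pi> = fst g / snd g"
    "if f differentiable (at (x, Y x)) then GDERIV f (x, Y x) :> g
     else quasi_subgradient f (x, Y x) g"
    using assms(1) by (auto simp: is_spot_price_def)
  have "quasi_subgradient f (x, Y x) g"
  proof (cases "f differentiable (at (x, Y x))")
    case True
    have "quasiconcave_on quadrant f" using trading by (simp add: is_trading_function_def)
    moreover have "(x, Y x) \<in> quadrant"
      using assms(2) Y_pos[of x] by (simp add: quadrant_def)
    ultimately show ?thesis
      using g(3) True by (simp add: gderiv_quasi_subgradient)
  qed (use g(3) in simp)
  then have *: "0 \<le> fst g * (a - x) + snd g * (b - Y x)"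
    if "0 < a" "0 < b" "c \<le> f (a, b)" for a b
  proof -
    have "0 \<le> g \<bullet> ((a, b) - (x, Y x))"
      using \<open>quasi_subgradient f (x, Y x) g\<close> that f_Y[OF assms(2)]
      unfolding quasi_subgradient_def quadrant_def by simp
    then show ?thesis by (simp add: inner_prod_def)
  qed
  \<comment> \<open>Raising \<open>y\<close> alone stays in the upper level set, which fixes the
    sign.\<close>
  have "0 \<le> snd g"
    using *[of x "Y x + 1"] upper_level_iff[of x "Y x + 1"] assms(2) Y_pos[of x] by simp
  with g(1) have "0 < snd g" by simp
  moreover have "0 \<le> fst g * (x' - x) + snd g * (Y x' - Y x)"
    using * assms Y_pos f_Y by simp
  ultimately show ?thesis
    by (simp add: g(2) field_simps)
qed

text \<open>The spot price passes from at least \<open>p\<close> at some \<open>l\<close> to below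
  \<open>p\<close> at some \<open>u\<close>. Supporting lines at these two points show that leaving
  \<open>[l, u]\<close> does not lower the value, so a minimum over this compact interval is
  global.\<close>

lemma value_minimizer:
  assumes "0 < p"
  obtains x where "0 < x" "\<And>x'. 0 < x' \<Longrightarrow> p * x + Y x \<le> p * x' + Y x'"
proof -
  \<comment> \<open>Any selection will do, since \<open>regular_level\<close> imposes the limits on
    all of them.\<close>
  obtain \<sigma> where \<sigma>: "\<And>x. 0 < x \<Longrightarrow> is_spot_price f (x, Y x) (\<sigma> x)"
    using regular[unfolded regular_level_def, THEN conjunct2, THEN conjunct1] by metis
  with regular have lim: "filterlim \<sigma> at_top (at_right 0)" "(\<sigma> \<longlongrightarrow> 0) at_top"
    by (simp_all add: regular_level_def)
  have "\<forall>\<^sub>F x in at_right 0. p \<le> \<sigma> x"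
    using lim(1) by (simp add: filterlim_at_top)
  then obtain b where b: "0 < b" "\<And>x. 0 < x \<Longrightarrow> x < b \<Longrightarrow> p \<le> \<sigma> x"
    by (auto simp: eventually_at_right_field)
  have "\<forall>\<^sub>F x in at_top. \<sigma> x < p"
    using lim(2) assms by (rule order_tendstoD)
  then obtain N where N: "\<And>x. N \<le> x \<Longrightarrow> \<sigma> x < p"
    by (auto simp: eventually_at_top_linorder)
  \<comment> \<open>Halving puts \<open>l\<close> strictly inside the range where the price is at
    least \<open>p\<close>; the maximum with \<open>b\<close> ensures
    \<open>l \<le> u\<close>.\<close>
  define l u where "l = b / 2" and "u = max N b"
  have l: "0 < l" "p \<le> \<sigma> l" and u: "l \<le> u" "\<sigma> u < p"
    using b N by (auto simp: l_def u_def)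
  have "continuous_on {l..u} (\<lambda>x. p * x + Y x)"
    using l(1) by (intro continuous_intros continuous_on_subset[OF continuous_on_Y]) auto
  then obtain x where x: "x \<in> {l..u}" "\<And>x'. x' \<in> {l..u} \<Longrightarrow> p * x + Y x \<le> p * x' + Y x'"
    using continuous_attains_inf[of "{l..u}" "\<lambda>x. p * x + Y x"] u by auto
  show thesis
  proof
    show "0 < x" using x l by simp
    fix x' :: real assume x': "0 < x'"
    consider "x' < l" | "x' \<in> {l..u}" | "u < x'" by fastforce
    then show "p * x + Y x \<le> p * x' + Y x'"
    proof cases
      case 1
      have "Y l - \<sigma> l * (x' - l) \<le> Y x'"
        using spot_price_subgradient \<sigma> l x' by blast
      moreover have "p * (l - x') \<le> \<sigma> l * (l - x')"
        using 1 l by (intro mult_right_mono) auto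
      moreover have "p * x + Y x \<le> p * l + Y l" using x u by simp
      ultimately show ?thesis by (simp add: algebra_simps)
    next
      case 2
      then show ?thesis by (rule x(2))
    next
      case 3
      have "Y u - \<sigma> u * (x' - u) \<le> Y x'"
        using spot_price_subgradient \<sigma> l u x' by force
      moreover have "\<sigma> u * (x' - u) \<le> p * (x' - u)"
        using 3 u by (intro mult_right_mono) auto
      moreover have "p * x + Y x \<le> p * u + Y u" using x u by simp
      ultimately show ?thesis by (simp add: algebra_simps)
    qed
  qed
qed

end

text \<open>Subtracting \<open>\<Y>(x)\<close> rather than \<open>snd s\<close> makes the fee of \<^term>\<open>return borel 0\<close> vanish off
  the regular level curves as well.\<close>

definition jensen_fee :: fee_rule where
  "jensen_fee f s M = (\<integral>\<eta>. level_y f (f s) (fst s + \<eta>) - level_y f (f s) (fst s) \<partial>M)"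

section \<open>The noiseless case\<close>

text \<open>For arbitrary \<open>f\<close> the integrand need not be measurable. If it is
  integrable, the point mass evaluates it at 0, where it cancels; otherwise the integral has its
  default value 0.\<close>

lemma jensen_fee_no_noise: "jensen_fee f s (return borel 0) = 0"
proof (cases "integrable (return borel 0)
    (\<lambda>\<eta>. level_y f (f s) (fst s + \<eta>) - level_y f (f s) (fst s))")
  case True
  then have "(\<lambda>\<eta>. level_y f (f s) (fst s + \<eta>) - level_y f (f s) (fst s)) \<in> borel_measurable borel"
    by (auto dest: borel_measurable_integrable)
  then show ?thesis by (simp add: jensen_fee_def integral_return)
next
  case False
  then show ?thesis by (simp add: jensen_fee_def not_integrable_integral_eq)
qed

text \<open>Viewing the plain CFMM as a zero-mean noisy one lets a single computation of the maximum
  serve both mechanisms.\<close>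

lemma no_noise_family: "is_noise_family no_noise"
  by (auto simp: is_noise_family_def no_noise_def prob_space_return AE_return intro!: exI[of _ 0])

lemma no_noise_zero_mean: "always_zero_mean no_noise"
  by (simp add: always_zero_mean_def no_noise_def integral_return)

section \<open>Upper bound for all strategies\<close>

text \<open>Induction on the strategy, with state, account and position general because they change
  during play; \<open>m\<close> bounds the value of the reserves left behind. The fee need agree
  with \<open>jensen_fee\<close> only on laws from \<open>D\<close>, which admits
  \<open>no_fee\<close> for \<open>no_noise\<close>.\<close>

lemma (in level_curve) expected_profit_le:
  assumes D: "is_noise_family D" "always_zero_mean D"
    and fee: "\<And>s \<Delta> \<epsilon> \<tau>. \<gamma> f s (D \<Delta> \<epsilon> \<tau>) = jensen_fee f s (D \<Delta> \<epsilon> \<tau>)"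
    and m: "\<And>x. 0 < x \<Longrightarrow> m \<le> p * x + Y x"
  shows "well_defined_profit f D \<gamma> p k s h q \<Longrightarrow> 0 < fst s \<Longrightarrow> snd s = Y (fst s) \<Longrightarrow>
    expected_profit f D \<gamma> p k s h q \<le> p * q + (p * fst s + Y (fst s)) - m"
proof (induction k arbitrary: s h q)
  case Stop
  with m[of "fst s"] show ?case by simp
next
  case (External v k)
  from External.IH[of s h "q - v"] External.prems show ?case by (simp add: algebra_simps)
next
  case (Request \<Delta> \<epsilon> \<tau> k)
  show ?case
  proof (cases "accepted f D s h \<Delta> \<epsilon> \<tau>")
    case False
    with Request.IH[of "k None" s h q] Request.prems show ?thesis by simp
  next
    case True
    define M where "M = D \<Delta> \<epsilon> \<tau>"
    define x1 where "x1 = fst s + \<Delta>"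
    have fs: "f s = c" using Request.prems f_Y[of "fst s"] by (cases s) simp
    have s1: "move f s \<Delta> = (x1, Y x1)" by (simp add: move_def x1_def fs)
    have x1: "0 < x1" and valid: "valid_request \<Delta> \<tau>"
      using True by (auto simp: accepted_def x1_def)
    have move1: "move f (x1, Y x1) \<eta> = (x1 + \<eta>, Y (x1 + \<eta>))" for \<eta>
      using f_Y[OF x1] by (simp add: move_def)
    interpret prob_space M
      using D(1) valid by (simp add: is_noise_family_def M_def)
    have sets_M [measurable_cong]: "sets M = sets borel"
      using D(1) valid by (simp add: is_noise_family_def M_def)
    have "\<exists>B. AE \<eta> in M. \<bar>\<eta>\<bar> \<le> B"
      using D(1) valid unfolding is_noise_family_def M_def by blast
    then obtain B where B: "AE \<eta> in M. \<bar>\<eta>\<bar> \<le> B" ..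
    \<comment> \<open>Bounded support makes the mean a genuine expectation, not the default value of
      a divergent integral, so linearity applies to it below.\<close>
    have int_id: "integrable M (\<lambda>\<eta>. \<eta>)"
      using B by (intro integrable_const_bound[of _ B]) auto
    have mean: "(\<integral>\<eta>. \<eta> \<partial>M) = 0"
      using D(2) valid by (simp add: always_zero_mean_def M_def)
    have "AE \<eta> in M. 0 < x1 + \<eta> \<and> 0 \<le> snd (account_after f (x1, Y x1) \<eta> h)"
      using True unfolding accepted_def s1 M_def x1_def[symmetric] by auto
    then have acc: "AE \<eta> in M. 0 < x1 + \<eta> \<and> Y (x1 + \<eta>) \<le> snd h + Y x1"
      by eventually_elim (simp add: account_after_def move1)
    \<comment> \<open>\<open>\<Y>\<close> may be unbounded near \<open>0\<close>: the limited amount of \<open>Y\<close> in the hidden account bounds it.\<close>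
    have int_Y: "integrable M (\<lambda>\<eta>. Y (x1 + \<eta>))"
    proof (rule integrable_const_bound)
      show "AE \<eta> in M. norm (Y (x1 + \<eta>)) \<le> snd h + Y x1"
        using acc by eventually_elim (use Y_pos in \<open>auto simp: less_imp_le\<close>)
    qed measurable
    have \<gamma>: "\<gamma> f (x1, Y x1) M = (\<integral>\<eta>. Y (x1 + \<eta>) \<partial>M) - Y x1"
      using fee[of "(x1, Y x1)" \<Delta> \<epsilon> \<tau>] int_Y f_Y[OF x1]
      by (simp add: M_def[symmetric] jensen_fee_def prob_space)
    define F where "F \<eta> = expected_profit f D \<gamma> p (k (Some (move f (x1, Y x1) \<eta>)))
      (move f (x1, Y x1) \<eta>) (account_after f (x1, Y x1) \<eta> h) (q - \<Delta>)" for \<eta>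
    have int_F: "integrable M F"
      and wd: "AE \<eta> in M. well_defined_profit f D \<gamma> p (k (Some (move f (x1, Y x1) \<eta>)))
        (move f (x1, Y x1) \<eta>) (account_after f (x1, Y x1) \<eta> h) (q - \<Delta>)"
      using Request.prems(1) True unfolding M_def F_def[abs_def] by (simp_all add: Let_def s1)
    \<comment> \<open>The induction hypothesis applies only at almost every outcome, where the
      continuation is well defined and the reserves are positive.\<close>
    have "AE \<eta> in M. F \<eta> \<le> p * (q - \<Delta>) + (p * (x1 + \<eta>) + Y (x1 + \<eta>)) - m"
      using wd acc
    proof eventually_elim
      case (elim \<eta>)
      from Request.IH[OF _ elim(1)] elim(2) show ?case
        by (simp add: F_def move1)
    qed
    then have "(\<integral>\<eta>. F \<eta> \<partial>M) \<le> (\<integral>\<eta>. p * (q - \<Delta>) + (p * (x1 + \<eta>) + Y (x1 + \<eta>)) - m \<partial>M)"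
      using int_F int_id int_Y by (intro integral_mono_AE) (auto simp: distrib_left)
    \<comment> \<open>Zero mean removes \<open>p * \<eta>\<close>; the remaining expectation of
      \<open>Y (x1 + \<eta>)\<close> is cancelled by the fee.\<close>
    also have "\<dots> = p * (q - \<Delta>) + p * x1 + (\<integral>\<eta>. Y (x1 + \<eta>) \<partial>M) - m"
      using int_id int_Y mean by (simp add: distrib_left prob_space)
    finally have F_le: "(\<integral>\<eta>. F \<eta> \<partial>M) \<le> \<dots>" .
    have profit: "expected_profit f D \<gamma> p (Request \<Delta> \<epsilon> \<tau> k) s h q =
        snd s - Y x1 - \<gamma> f (x1, Y x1) M + (\<integral>\<eta>. F \<eta> \<partial>M)"
      using True by (simp add: Let_def s1 M_def F_def[abs_def])
    show ?thesis
      unfolding profit \<gamma> Request.prems(3) using F_le by (simp add: x1_def algebra_simps)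
  qed
qed

section \<open>Attainment and equality of the two maxima\<close>

lemma (in level_curve) is_max_profit_jensen:
  assumes D: "is_noise_family D" "always_zero_mean D"
    and fee: "\<And>s \<Delta> \<epsilon> \<tau>. \<gamma> f s (D \<Delta> \<epsilon> \<tau>) = jensen_fee f s (D \<Delta> \<epsilon> \<tau>)"
    and z: "0 < z" "\<And>x. 0 < x \<Longrightarrow> p * z + Y z \<le> p * x + Y x"
    and s: "0 < fst s" "snd s = Y (fst s)"
    and h: "0 \<le> fst h" "0 \<le> snd h"
  shows "is_max_profit f D \<gamma> p s h (p * fst s + Y (fst s) - (p * z + Y z))"
  unfolding is_max_profit_def
proof (intro conjI exI allI impI)
  fix k assume "well_defined_profit f D \<gamma> p k s h 0"
  from expected_profit_le[of D \<gamma> "p * z + Y z" p, OF D fee z(2) this s]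
  show "expected_profit f D \<gamma> p k s h 0 \<le> p * fst s + Y (fst s) - (p * z + Y z)" by simp
next
  \<comment> \<open>This trade moves the reserves to the minimizer \<open>z\<close>. Requesting it
    with \<open>{\<Delta>}\<close> and \<open>top\<close> forces zero noise and hence zero
    fee.\<close>
  define \<Delta> where "\<Delta> = z - fst s"
  have valid: "valid_request \<Delta> {\<Delta>}" by (auto simp: valid_request_def intro!: exI[of _ \<Delta>])
  have D0: "D \<Delta> top {\<Delta>} = return borel 0" using D(1) valid by (simp add: is_noise_family_def)
  have fs: "f s = c" using s f_Y[of "fst s"] by (cases s) simp
  have s1: "move f s \<Delta> = (z, Y z)" by (simp add: move_def fs \<Delta>_def)
  \<comment> \<open>Zero noise leaves the hidden account as it was, so its initial nonnegativity
    suffices.\<close>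
  have acc: "accepted f D s h \<Delta> top {\<Delta>}"
    unfolding accepted_def D0
  proof (intro conjI)
    have "AE \<eta> in return borel 0. \<eta> = (0 :: real)" by (simp add: AE_return)
    then show "AE \<eta> in return borel 0. 0 < fst s + \<Delta> + \<eta> \<and>
        0 \<le> fst (account_after f (move f s \<Delta>) \<eta> h) \<and> 0 \<le> snd (account_after f (move f s \<Delta>) \<eta> h)"
      unfolding s1
      by eventually_elim (use h z(1) f_Y[OF z(1)] in \<open>simp add: account_after_def move_def \<Delta>_def\<close>)
  qed (use valid z(1) in \<open>simp_all add: \<Delta>_def\<close>)
  interpret prob_space "return borel (0 :: real)" by (rule prob_space_return) simp
  let ?k = "Request \<Delta> top {\<Delta>} (\<lambda>_. Stop)"
  show "well_defined_profit f D \<gamma> p ?k s h 0"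
    using acc by (simp add: D0)
  have "\<gamma> f (z, Y z) (return borel 0) = 0"
    using fee[of "(z, Y z)" \<Delta> top "{\<Delta>}"] by (simp add: D0 jensen_fee_no_noise)
  \<comment> \<open>The wealth upon \<open>Stop\<close> is the constant
    \<open>- p * \<Delta>\<close>, whose integral carries the total mass as a factor.\<close>
  moreover have "measure (return borel (0::real)) UNIV = 1"
    using prob_space by simp
  ultimately have "expected_profit f D \<gamma> p ?k s h 0 = snd s - Y z - p * \<Delta>"
    using acc by (simp add: D0 s1 Let_def)
  then show "expected_profit f D \<gamma> p ?k s h 0 = p * fst s + Y (fst s) - (p * z + Y z)"
    unfolding s(2) \<Delta>_def by (simp add: algebra_simps)
qed

theorem corollary4p7:
  fixes f :: trading_function and D :: noise_family
  assumes "noisy_cfmm f D"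
    and "always_zero_mean D"
  shows "priceable f D"
  unfolding priceable_def
proof (intro exI conjI allI impI)
  show "jensen_fee f s (return borel 0) = 0" for s
    by (rule jensen_fee_no_noise)
  fix p :: real and s h :: "real \<times> real"
  assume p: "0 < p" and sh: "cfmm_state f s \<and> 0 \<le> fst h \<and> 0 \<le> snd h"
  interpret level_curve f "f s"
    using assms(1) sh by unfold_locales (auto simp: noisy_cfmm_def cfmm_state_def)
  obtain z where z: "0 < z" "\<And>x. 0 < x \<Longrightarrow> p * z + Y z \<le> p * x + Y x"
    using value_minimizer[OF p] by blast
  have s: "0 < fst s" "snd s = Y (fst s)"
    using sh Y_unique[of "fst s" "snd s"] by (auto simp: cfmm_state_def)
  \<comment> \<open>This value depends neither on the noise law nor on the fee, so the two maxima
    coincide.\<close>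
  let ?m = "p * fst s + Y (fst s) - (p * z + Y z)"
  have "is_max_profit f D jensen_fee p s h ?m"
    using assms z s sh by (intro is_max_profit_jensen) (auto simp: noisy_cfmm_def)
  moreover have "is_max_profit f no_noise no_fee p s h ?m"
    using z s sh no_noise_family no_noise_zero_mean
    by (intro is_max_profit_jensen) (auto simp: no_fee_def no_noise_def jensen_fee_no_noise)
  ultimately show "is_additional_arbitrage f D jensen_fee p s h 0"
    unfolding is_additional_arbitrage_def by (intro exI[of _ ?m]) simp
qed

end
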